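(* Let $\mathbf A$ be a balanced residuated partially ordered semigroup with carrier $A$. Let $(\mathcal R_n)_{n\ge0}$ and $(\mathcal S_n)_{n\ge0}$ be frontier partitions of $A$, where $(\mathcal R_n)$ is obtained by iterating the residual coherentization step and $(\mathcal S_n)$ is obtained by iterating a subsemilattice-steady visibility step: for each nonterminal induced component $\mathbf B$ one chooses a nonempty visible subsemilattice $I_{\mathbf B}\subseteq\operatorname{Sk}(\mathbf B)$ such that $\mathbf B$ is subsemilattice-steady over $I_{\mathbf B}$ and such that the nonempty fibres $B^{I_{\mathbf B}}_p=\{b\in B:\pi_{I_{\mathbf B}}(\tau_{\mathbf B}(b))=p\}$, $p\in I_{\mathbf B}$, are (with the inherited structure) induced component subalgebras of $\mathbf B$, and one replaces $\mathbf B$ by these induced component subalgebras, terminal components being carried forward unchanged. Then $$\mathcal R_n\le\mathcal S_n\qquad(n\ge0),$$ where $\le$ denotes refinement of partitions. Consequently, whenever the frontier partitions are finite, $|\mathcal R_n|\ge|\mathcal S_n|$ for all $n\ge0$. If the subsemilattice-steady iteration terminates with terminal frontier $\mathcal S_N$ and the residual iteration terminates with terminal frontier $\mathcal R_M$, then $\mathcal R_M\le\mathcal S_N$. The induced component algebras on the members of $\mathcal R_M$ are precisely the terminal $\tau$-residuation-cohesive residual components. Thus every terminal residual component is contained in a unique terminal subsemilattice-steady component, and every terminal subsemilattice-steady component is the disjoint union of the terminal $\tau$-residuation-cohesive residual components contained in it. In particular $|\mathcal R_M|\ge|\mathcal S_N|$. Each terminal $\tau$-residuation-cohesive residual component is an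 induced (balanced residuated) component subalgebra of the terminal subsemilattice-steady component which contains it.
   Context: A residuated partially ordered semigroup is a structure $\mathbf B=\langle B,\le,\cdot,\backslash,/\rangle$ with $\langle B,\le\rangle$ a poset, $\langle B,\cdot\rangle$ a semigroup, and $xy\le z\iff x\le z/y\iff y\le x\backslash z$. An element $p\in B$ is positive if $z\le zp$ and $z\le pz$ for all $z\in B$. $\mathbf B$ is balanced if for every $x\in B$ one has $x\backslash x=x/x$ and this common value is positive; it is then automatically idempotent. Put $\tau_{\mathbf B}(x)=\tau(x):=x\backslash x=x/x$. The skeleton $\operatorname{Sk}(\mathbf B)$ is the set of positive idempotents with the order inherited from $\mathbf B$; it is a join-semilattice in which $u\vee v=uv=vu$. For $P\subseteq S=\operatorname{Sk}(\mathbf B)$ put $L_P:=\{x\in B:\tau(x)\in P\}$. Partitions are ordered by refinement: $\Theta\le\Phi$ iff every block of $\Theta$ is contained in a block of $\Phi$. For $P,Q\subseteq S$ put $P\star_\tau Q:=\{\tau(xy),\tau(x\backslash y),\tau(x/y): x\in L_P,\ y\in L_Q\}$. For a partition $\Theta$ of $S$ and $P,Q\in\Theta$ put $\operatorname{Out}_\Theta(P,Q):=\{C\in\Theta: C\cap(P\star_\tau Q)\neq\varnothing\}$; $\Theta$ is $\tau$-residuation-coherent if all sets $\operatorname{Out}_\Theta(P,Q)$ are singletons. Form the graph on the blocks of $\Theta$ joining distinct blocks $C,D$ whenever there are $P,Q\in\Theta$ with $C,D\in\operatorname{Out}_\Theta(P,Q)$; $\operatorname{CC}_{\mathrm r}(\Theta)$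 is obtained by merging precisely the blocks lying in the same connected component. Let $\Theta_0=\{\{u\}:u\in S\}$, $\Theta_{n+1}=\operatorname{CC}_{\mathrm r}(\Theta_n)$, let $\equiv_n$ be the equivalence relation of $\Theta_n$; the residual coherentization $\mathcal C_{\mathrm r}(\mathbf B)$ is the partition of $S$ into the classes of $\bigcup_{n<\omega}\equiv_n$ (the finest $\tau$-residuation-coherent partition of $S$). $\mathbf B$ is $\tau$-residuation-cohesive if $\mathcal C_{\mathrm r}(\mathbf B)=\{S\}$. Residual coherentization step: $\mathbf B$ is replaced by its components $L_C=\{x\in B:\tau_{\mathbf B}(x)\in C\}$, $C\in\mathcal C_{\mathrm r}(\mathbf B)$, each with the order and operations restricted from $\mathbf B$ (under which it is closed and forms a balanced residuated partially ordered semigroup). Induced component subalgebra of $\mathbf B$: a balanced residuated partially ordered semigroup $\mathbf C$ with carrier $C\subseteq B$ whose order, multiplication and residuals are the restrictions of those of $\mathbf B$, and with $\operatorname{Sk}(\mathbf C)=\operatorname{Sk}(\mathbf B)\cap C$. Visibility: a nonempty subsemilattice $I\subseteq\operatorname{Sk}(\mathbf B)$ (closed under products, i.e. joins) is visible if $\pi_I(r)=\max\{p\in I:p\le r\}$ exists for every $r\in\operatorname{Sk}(\mathbf B)$. Put $u_b=\pi_I(\tau_{\mathbf B}(b))$ for $b\in B$. $\mathbf B$ is subsemilattice-steady over $I$ if $u_{ab}=u_{a\backslash b}=u_{a/b}=u_au_b$ for all $a,b\in B$. Frontier partitions: for an iterated decomposition procedure on $\mathbf A$, a component is terminal if one more application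 of the procedure produces no proper refinement of that component (for the residual procedure this means exactly that the component algebra is $\tau$-residuation-cohesive). Put $\mathcal F_0=\{A\}$; given $\mathcal F_n$, the partition $\mathcal F_{n+1}$ of $A$ is obtained by replacing each nonterminal component of $\mathcal F_n$ by the components produced by one application of the procedure inside it, and carrying each terminal component forward unchanged. The iteration terminates with terminal frontier $\mathcal F_N$ if all members of $\mathcal F_N$ are terminal (so $\mathcal F_m=\mathcal F_N$ for all $m\ge N$). *)

theory Defs
  imports "HOL-Library.Disjoint_Sets" "HOL-Library.Equipollence"
begin

section \<open>Balanced residuated partially ordered semigroups\<close>

text \<open>
  The relation and the operations are total functions on the type; only their values on
  \<^term>\<open>carrier\<close> matter.  Here \<open>ldiv x z\<close> is the left residual x \ z and \<open>rdiv z y\<close> is the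
  right residual z / y.
\<close>

record 'a rposg =
  carrier :: "'a set"
  le :: "'a \<Rightarrow> 'a \<Rightarrow> bool"
  mult :: "'a \<Rightarrow> 'a \<Rightarrow> 'a"
  ldiv :: "'a \<Rightarrow> 'a \<Rightarrow> 'a"
  rdiv :: "'a \<Rightarrow> 'a \<Rightarrow> 'a"

definition residuated_posemigroup :: "'a rposg \<Rightarrow> bool" where
  "residuated_posemigroup B \<longleftrightarrow>
     carrier B \<noteq> {} \<and>
     reflp_on (carrier B) (le B) \<and> antisymp_on (carrier B) (le B) \<and> transp_on (carrier B) (le B) \<and>
     (\<forall>x\<in>carrier B. \<forall>y\<in>carrier B.
        mult B x y \<in> carrier B \<and> ldiv B x y \<in> carrier B \<and> rdiv B x y \<in> carrier B) \<and>
     (\<forall>x\<in>carrier B. \<forall>y\<in>carrier B. \<forall>z\<in>carrier B.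
        mult B (mult B x y) z = mult B x (mult B y z)) \<and>
     (\<forall>x\<in>carrier B. \<forall>y\<in>carrier B. \<forall>z\<in>carrier B.
        (le B (mult B x y) z \<longleftrightarrow> le B x (rdiv B z y)) \<and>
        (le B (mult B x y) z \<longleftrightarrow> le B y (ldiv B x z)))"

definition positive :: "'a rposg \<Rightarrow> 'a \<Rightarrow> bool" where
  "positive B p \<longleftrightarrow>
     p \<in> carrier B \<and> (\<forall>z\<in>carrier B. le B z (mult B z p) \<and> le B z (mult B p z))"

definition balanced :: "'a rposg \<Rightarrow> bool" where
  "balanced B \<longleftrightarrow> residuated_posemigroup B \<and>
     (\<forall>x\<in>carrier B. ldiv B x x = rdiv B x x \<and> positive B (ldiv B x x))"

definition tau :: "'a rposg \<Rightarrow> 'a \<Rightarrow> 'a" where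
  "tau B x = ldiv B x x"

definition Sk :: "'a rposg \<Rightarrow> 'a set" where
  "Sk B = {p. positive B p \<and> mult B p p = p}"

definition induced_component :: "'a rposg \<Rightarrow> 'a rposg \<Rightarrow> bool" where
  "induced_component C B \<longleftrightarrow>
     balanced C \<and> carrier C \<subseteq> carrier B \<and>
     (\<forall>x\<in>carrier C. \<forall>y\<in>carrier C.
        (le C x y \<longleftrightarrow> le B x y) \<and> mult C x y = mult B x y \<and>
        ldiv C x y = ldiv B x y \<and> rdiv C x y = rdiv B x y) \<and>
     Sk C = Sk B \<inter> carrier C"

definition restr :: "'a rposg \<Rightarrow> 'a set \<Rightarrow> 'a rposg" where
  "restr B X = B\<lparr>carrier := X\<rparr>"

section \<open>Residual coherentization\<close>

definition level :: "'a rposg \<Rightarrow> 'a set \<Rightarrow> 'a set" where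
  "level B P = {x\<in>carrier B. tau B x \<in> P}"

definition tau_star :: "'a rposg \<Rightarrow> 'a set \<Rightarrow> 'a set \<Rightarrow> 'a set" where
  "tau_star B P Q =
     (\<Union>x\<in>level B P. \<Union>y\<in>level B Q.
        {tau B (mult B x y), tau B (ldiv B x y), tau B (rdiv B x y)})"

definition Out :: "'a rposg \<Rightarrow> 'a set set \<Rightarrow> 'a set \<Rightarrow> 'a set \<Rightarrow> 'a set set" where
  "Out B \<Theta> P Q = {C\<in>\<Theta>. C \<inter> tau_star B P Q \<noteq> {}}"

definition block_graph :: "'a rposg \<Rightarrow> 'a set set \<Rightarrow> ('a set \<times> 'a set) set" where
  "block_graph B \<Theta> =
     {(C, D). C \<noteq> D \<and> (\<exists>P\<in>\<Theta>. \<exists>Q\<in>\<Theta>. C \<in> Out B \<Theta> P Q \<and> D \<in> Out B \<Theta> P Q)}"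

definition CC_r :: "'a rposg \<Rightarrow> 'a set set \<Rightarrow> 'a set set" where
  "CC_r B \<Theta> = (\<lambda>C. \<Union>{D\<in>\<Theta>. (C, D) \<in> (block_graph B \<Theta>)\<^sup>*}) ` \<Theta>"

definition Theta :: "'a rposg \<Rightarrow> nat \<Rightarrow> 'a set set" where
  "Theta B n = (CC_r B ^^ n) ((\<lambda>u. {u}) ` Sk B)"

definition coherentization :: "'a rposg \<Rightarrow> 'a set set" where
  "coherentization B = Sk B // (\<Union>n. {(u, v). \<exists>C\<in>Theta B n. u \<in> C \<and> v \<in> C})"

definition residuation_cohesive :: "'a rposg \<Rightarrow> bool" where
  "residuation_cohesive B \<longleftrightarrow> coherentization B = {Sk B}"

section \<open>Subsemilattice-steady visibility\<close>

definition is_proj :: "'a rposg \<Rightarrow> 'a set \<Rightarrow> 'a \<Rightarrow> 'a \<Rightarrow> bool" where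
  "is_proj B I r m \<longleftrightarrow> m \<in> I \<and> le B m r \<and> (\<forall>p\<in>I. le B p r \<longrightarrow> le B p m)"

definition proj :: "'a rposg \<Rightarrow> 'a set \<Rightarrow> 'a \<Rightarrow> 'a" where
  "proj B I r = (THE m. is_proj B I r m)"

definition visible_subsemilattice :: "'a rposg \<Rightarrow> 'a set \<Rightarrow> bool" where
  "visible_subsemilattice B I \<longleftrightarrow>
     I \<noteq> {} \<and> I \<subseteq> Sk B \<and> (\<forall>p\<in>I. \<forall>q\<in>I. mult B p q \<in> I) \<and>
     (\<forall>r\<in>Sk B. \<exists>m. is_proj B I r m)"

definition steady_over :: "'a rposg \<Rightarrow> 'a set \<Rightarrow> bool" where
  "steady_over B I \<longleftrightarrow>
     (let u = (\<lambda>b. proj B I (tau B b)) in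
      \<forall>a\<in>carrier B. \<forall>b\<in>carrier B.
        u (mult B a b) = mult B (u a) (u b) \<and>
        u (ldiv B a b) = mult B (u a) (u b) \<and>
        u (rdiv B a b) = mult B (u a) (u b))"

definition fibre :: "'a rposg \<Rightarrow> 'a set \<Rightarrow> 'a \<Rightarrow> 'a set" where
  "fibre B I p = {b\<in>carrier B. proj B I (tau B b) = p}"

definition fibres :: "'a rposg \<Rightarrow> 'a set \<Rightarrow> 'a set set" where
  "fibres B I = fibre B I ` I - {{}}"

definition admissible :: "'a rposg \<Rightarrow> 'a set \<Rightarrow> bool" where
  "admissible B I \<longleftrightarrow>
     visible_subsemilattice B I \<and> steady_over B I \<and>
     (\<forall>F\<in>fibres B I. induced_component (restr B F) B)"

section \<open>Decomposition procedures and their frontiers\<close>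

text \<open>
  A procedure involving choices is modelled by the set of all possible outcomes of one
  application to an algebra; an outcome is the family of the carriers of the components it
  produces.  An algebra with no outcome other than the trivial one (in particular, one to which
  the procedure cannot be applied) is terminal.
\<close>

type_synonym 'a procedure = "'a rposg \<Rightarrow> 'a set set set"

definition terminal :: "'a procedure \<Rightarrow> 'a rposg \<Rightarrow> bool" where
  "terminal \<P> B \<longleftrightarrow> (\<forall>D\<in>\<P> B. D = {carrier B})"

definition frontier_sequence :: "'a procedure \<Rightarrow> 'a rposg \<Rightarrow> (nat \<Rightarrow> 'a set set) \<Rightarrow> bool" where
  "frontier_sequence \<P> A \<F> \<longleftrightarrow>
     \<F> 0 = {carrier A} \<and>
     (\<forall>n. \<exists>dec.
        (\<forall>X\<in>\<F> n. \<not> terminal \<P> (restr A X) \<longrightarrow> dec X \<in> \<P> (restr A X)) \<and>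
        \<F> (Suc n) = (\<Union>X\<in>\<F> n. if terminal \<P> (restr A X) then {X} else dec X))"

definition terminates_at :: "'a procedure \<Rightarrow> 'a rposg \<Rightarrow> (nat \<Rightarrow> 'a set set) \<Rightarrow> nat \<Rightarrow> bool" where
  "terminates_at \<P> A \<F> N \<longleftrightarrow> (\<forall>X\<in>\<F> N. terminal \<P> (restr A X))"

definition terminal_components ::
    "'a procedure \<Rightarrow> 'a rposg \<Rightarrow> (nat \<Rightarrow> 'a set set) \<Rightarrow> 'a set set" where
  "terminal_components \<P> A \<F> = {X. \<exists>n. X \<in> \<F> n \<and> terminal \<P> (restr A X)}"

definition residual_step :: "'a procedure" where
  "residual_step B = {level B ` coherentization B}"

text \<open>
  Any rule for selecting the visible subsemilattices is allowed: a fixed assignment of one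
  admissible subsemilattice to each component (at most one outcome per algebra), as well as a
  free choice among all admissible ones.
\<close>

definition steady_visibility_procedure :: "'a procedure \<Rightarrow> bool" where
  "steady_visibility_procedure \<P> \<longleftrightarrow>
     (\<forall>B. \<forall>D\<in>\<P> B. \<exists>I. admissible B I \<and> D = fibres B I)"

end

theory Submission
  imports Defs
begin

text \<open>
  On the skeleton of a component Y, the map u to \<open>\<pi>\<^sub>I(u)\<close> sends the type \<open>\<tau>\<close> of each of \<open>xy\<close>, x \ y
  and \<open>x/y\<close> to the product of the images of \<open>\<tau>(x)\<close> and \<open>\<tau>(y)\<close>; this is what steadiness says.
  It stays true on every subalgebra X of Y, so the kernel of the map is a coherent equivalence on the
  skeleton of X and contains the coherentization of X, the finest one.  Hence every
  residual component of X lies in a single fibre of Y, and refinement propagates from one stage to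
  the next.  No case distinction on the residual side is needed: a terminal X is its own
  unique residual component.
\<close>

section \<open>Subalgebras of a balanced algebra\<close>

lemma restr_simps [simp]:
  "carrier (restr B X) = X" "le (restr B X) = le B" "mult (restr B X) = mult B"
  "ldiv (restr B X) = ldiv B" "rdiv (restr B X) = rdiv B" "tau (restr B X) = tau B"
  "restr (restr B X) Y = restr B Y"
  by (simp_all add: restr_def tau_def fun_eq_iff)

text \<open>For a nonempty subset of a balanced algebra this closure alone yields an induced
  component (\<open>induced_component_restr\<close>), so it is the condition tracked along the
  frontiers.\<close>

definition op_closed :: "'a rposg \<Rightarrow> 'a set \<Rightarrow> bool" where
  "op_closed B X \<longleftrightarrow> (\<forall>x\<in>X. \<forall>y\<in>X. mult B x y \<in> X \<and> ldiv B x y \<in> X \<and> rdiv B x y \<in> X)"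

section \<open>\<open>tau\<close> as a retraction of the carrier onto the skeleton\<close>

lemma balanced_residuated: "balanced B \<Longrightarrow> residuated_posemigroup B"
  by (simp add: balanced_def)

lemma balanced_carrier_nonempty: "balanced B \<Longrightarrow> carrier B \<noteq> {}"
  by (simp add: balanced_def residuated_posemigroup_def)

lemma balanced_op_closed: "balanced B \<Longrightarrow> op_closed B (carrier B)"
  by (simp add: balanced_def residuated_posemigroup_def op_closed_def)

lemma Sk_subset_carrier: "Sk B \<subseteq> carrier B"
  by (auto simp: Sk_def positive_def)

text \<open>Put \<open>q = ldiv B p p\<close>. Idempotence and residuation give
  \<open>p \<le> q\<close>; positivity and then residuation give
  \<open>q \<le> pq \<le> p\<close>.\<close>

lemma tau_Sk:
  assumes "residuated_posemigroup B" "p \<in> Sk B"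
  shows "tau B p = p"
proof -
  have p: "p \<in> carrier B" and pp: "mult B p p = p"
    and pos: "\<And>z. z \<in> carrier B \<Longrightarrow> le B z (mult B p z)"
    using assms(2) by (auto simp: Sk_def positive_def)
  have refl: "reflp_on (carrier B) (le B)" and anti: "antisymp_on (carrier B) (le B)"
    and trans: "transp_on (carrier B) (le B)"
    and cl: "\<And>x y. x \<in> carrier B \<Longrightarrow> y \<in> carrier B \<Longrightarrow>
      mult B x y \<in> carrier B \<and> ldiv B x y \<in> carrier B"
    and res: "\<And>x y z. x \<in> carrier B \<Longrightarrow> y \<in> carrier B \<Longrightarrow> z \<in> carrier B \<Longrightarrow>
      le B (mult B x y) z \<longleftrightarrow> le B y (ldiv B x z)"
    using assms(1) unfolding residuated_posemigroup_def by blast+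
  let ?q = "ldiv B p p"
  have q: "?q \<in> carrier B" using cl p by blast
  have "le B p ?q" using res[of p p p] p pp refl by (simp add: reflp_onD)
  moreover have "le B (mult B p ?q) p" using res[of p ?q p] p q refl by (simp add: reflp_onD)
  then have "le B ?q p"
    using transp_onD[OF trans q _ p pos[OF q]] cl p q by blast
  ultimately show ?thesis
    unfolding tau_def using antisymp_onD[OF anti] p q by blast
qed

text \<open>Balance makes \<open>q = ldiv B x x = rdiv B x x\<close> positive, whence
  \<open>q \<le> qq\<close>. Conversely \<open>qx \<le> x\<close> applied twice gives
  \<open>qqx \<le> x\<close>, that is \<open>qq \<le> rdiv B x x = q\<close>.\<close>

lemma tau_in_Sk:
  assumes "balanced B" "x \<in> carrier B"
  shows "tau B x \<in> Sk B"
proof -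
  have refl: "reflp_on (carrier B) (le B)" and anti: "antisymp_on (carrier B) (le B)"
    and trans: "transp_on (carrier B) (le B)"
    and cl: "\<And>x y. x \<in> carrier B \<Longrightarrow> y \<in> carrier B \<Longrightarrow>
      mult B x y \<in> carrier B \<and> ldiv B x y \<in> carrier B"
    and assoc: "\<And>x y z. x \<in> carrier B \<Longrightarrow> y \<in> carrier B \<Longrightarrow> z \<in> carrier B \<Longrightarrow>
      mult B (mult B x y) z = mult B x (mult B y z)"
    and resr: "\<And>x y z. x \<in> carrier B \<Longrightarrow> y \<in> carrier B \<Longrightarrow> z \<in> carrier B \<Longrightarrow>
      le B (mult B x y) z \<longleftrightarrow> le B x (rdiv B z y)"
    and res: "\<And>x y z. x \<in> carrier B \<Longrightarrow> y \<in> carrier B \<Longrightarrow> z \<in> carrier B \<Longrightarrow>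
      le B (mult B x y) z \<longleftrightarrow> le B y (ldiv B x z)"
    and pos: "positive B (ldiv B x x)" and eq: "ldiv B x x = rdiv B x x"
    using assms unfolding balanced_def residuated_posemigroup_def by blast+
  let ?q = "ldiv B x x"
  have x: "x \<in> carrier B" and q: "?q \<in> carrier B" using cl assms(2) by auto
  have qq: "mult B ?q ?q \<in> carrier B" and qx: "mult B ?q x \<in> carrier B" using cl q x by auto
  have le: "le B (mult B ?q x) x"
    using resr[of ?q x x] q x refl eq by (simp add: reflp_onD)
  \<comment> \<open>Residuation stands in for monotonicity: \<open>qx \<le> x\<close> gives
    \<open>x \<le> ldiv B q x\<close>, so \<open>qx \<le> ldiv B q x\<close> by transitivity, and
    one residuates back.\<close>
  then have "le B (mult B ?q (mult B ?q x)) x"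
    using resr[OF q qx x] resr[OF q x x] resr[OF qq x x] res[OF q qx x] res[OF q x x]
      transp_onD[OF trans qx x _ le] cl[OF q x] by blast
  then have "le B (mult B ?q ?q) ?q"
    using resr[OF qq x x] assoc[OF q q x] eq by simp
  moreover have "le B ?q (mult B ?q ?q)"
    using pos q by (simp add: positive_def)
  ultimately have "mult B ?q ?q = ?q"
    using antisymp_onD[OF anti qq q] by blast
  with pos show ?thesis by (simp add: Sk_def tau_def)
qed

lemma induced_component_restr:
  assumes B: "balanced B" and X: "X \<subseteq> carrier B" "X \<noteq> {}" "op_closed B X"
  shows "induced_component (restr B X) B"
proof -
  have "residuated_posemigroup B" using B by (simp add: balanced_def)
  then have res: "residuated_posemigroup (restr B X)"
    using X unfolding residuated_posemigroup_def op_closed_def restr_simps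
    by (intro conjI) (blast intro: reflp_on_subset antisymp_on_subset transp_on_subset)+
  have pos: "positive (restr B X) p" if "positive B p" "p \<in> X" for p
    using that X(1) by (auto simp: positive_def)
  have bal: "balanced (restr B X)"
    unfolding balanced_def restr_simps
  proof (intro conjI ballI)
    fix x assume "x \<in> X"
    then have x: "x \<in> carrier B" "ldiv B x x \<in> X" using X by (auto simp: op_closed_def)
    then show "ldiv B x x = rdiv B x x" "positive (restr B X) (ldiv B x x)"
      using B pos by (auto simp: balanced_def)
  qed (rule res)
  \<comment> \<open>Positivity in \<open>X\<close> tests only elements of \<open>X\<close>, so it
    does not lift directly. But \<open>p\<close> equals its own \<open>tau\<close>, which is the
    same operation in \<open>B\<close>, and \<open>tau\<close> takes values in \<open>Sk B\<close>
    there.\<close>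
  have "Sk (restr B X) \<subseteq> Sk B"
  proof
    fix p assume p: "p \<in> Sk (restr B X)"
    then have "p \<in> carrier B" using Sk_subset_carrier[of "restr B X"] X(1) by auto
    with tau_in_Sk[OF B] tau_Sk[OF res p] show "p \<in> Sk B" by fastforce
  qed
  then have "Sk (restr B X) = Sk B \<inter> X"
    using pos Sk_subset_carrier[of "restr B X"] by (auto simp: Sk_def)
  with bal X(1) show ?thesis by (simp add: induced_component_def)
qed

lemma balanced_restr:
  assumes "balanced B" "X \<subseteq> carrier B" "X \<noteq> {}" "op_closed B X"
  shows "balanced (restr B X)" "Sk (restr B X) = Sk B \<inter> X"
  using induced_component_restr[OF assms] by (auto simp: induced_component_def)

section \<open>The residual coherentization\<close>

definition coh :: "'a rposg \<Rightarrow> ('a \<times> 'a) set" where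
  "coh B = (\<Union>n. {(u, v). \<exists>C\<in>Theta B n. u \<in> C \<and> v \<in> C})"

lemma coherentization_eq: "coherentization B = Sk B // coh B"
  by (simp add: coherentization_def coh_def)

lemma sym_block_graph: "sym (block_graph B \<Theta>)"
  by (auto simp: sym_def block_graph_def)

text \<open>Reachability in a symmetric graph is an equivalence. A point common to two merged blocks
  lies in a single old block, which connects the two starting blocks.\<close>

lemma partition_on_CC_r:
  assumes "partition_on S \<Theta>"
  shows "partition_on S (CC_r B \<Theta>)"
proof (rule partition_onI)
  let ?G = "(block_graph B \<Theta>)\<^sup>*"
  show "\<Union> (CC_r B \<Theta>) = S"
    using partition_onD1[OF assms] by (auto simp: CC_r_def)
  show "{} \<notin> CC_r B \<Theta>"
    using partition_onD3[OF assms] by (auto simp: CC_r_def)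
  have sym: "sym ?G" and trans: "trans ?G"
    by (auto simp: sym_rtrancl sym_block_graph trans_rtrancl)
  fix p q assume "p \<in> CC_r B \<Theta>" "q \<in> CC_r B \<Theta>" and ne: "p \<noteq> q"
  then obtain C D where C: "C \<in> \<Theta>" "p = \<Union>{E\<in>\<Theta>. (C, E) \<in> ?G}"
    and D: "D \<in> \<Theta>" "q = \<Union>{E\<in>\<Theta>. (D, E) \<in> ?G}"
    by (auto simp: CC_r_def)
  show "disjnt p q"
  proof (rule ccontr)
    assume "\<not> disjnt p q"
    then obtain x E E' where "x \<in> E" "x \<in> E'" "E \<in> \<Theta>" "E' \<in> \<Theta>" "(C, E) \<in> ?G" "(D, E') \<in> ?G"
      using C D by (auto simp: disjnt_def)
    moreover from this have "E = E'"
      using partition_onD2[OF assms] by (auto simp: disjoint_def)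
    ultimately have "(C, D) \<in> ?G" "(D, C) \<in> ?G"
      using sym trans by (meson symD transD)+
    then have "p = q" unfolding C(2) D(2) using trans by (meson transD)
    with ne show False by simp
  qed
qed

lemma partition_on_Theta: "partition_on (Sk B) (Theta B n)"
  by (induction n) (simp_all add: Theta_def partition_on_singletons partition_on_CC_r)

text \<open>Each block lies in its own connected component, so classes only grow. This lets data
  from two stages be compared at the later one.\<close>

lemma Theta_mono:
  assumes "C \<in> Theta B m" "m \<le> n"
  shows "\<exists>D\<in>Theta B n. C \<subseteq> D"
  using assms(2)
proof (induction n rule: dec_induct)
  case base
  then show ?case using assms(1) by blast
next
  case (step n)
  then obtain D where D: "D \<in> Theta B n" "C \<subseteq> D" by blast
  have "Theta B (Suc n) = CC_r B (Theta B n)" by (simp add: Theta_def)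
  with D show ?case by (auto simp: CC_r_def)
qed

text \<open>For transitivity, the two witnessing blocks are enlarged to stage
  \<open>max m n\<close>, where they share \<open>v\<close> and hence coincide.\<close>

lemma equiv_coh: "equiv (Sk B) (coh B)"
proof (rule equivI)
  have un: "u \<in> Sk B \<longleftrightarrow> (\<exists>C\<in>Theta B n. u \<in> C)" for u n
    using partition_onD1[OF partition_on_Theta, of B n] by simp
  show "coh B \<subseteq> Sk B \<times> Sk B"
    unfolding coh_def using un by blast
  show "refl_on (Sk B) (coh B)"
    unfolding coh_def refl_on_def using un by blast
  show "sym (coh B)"
    unfolding sym_def coh_def by blast
  show "trans (coh B)"
  proof (rule transI)
    fix u v w assume "(u, v) \<in> coh B" "(v, w) \<in> coh B"
    then obtain m n C D where C: "C \<in> Theta B m" "u \<in> C" "v \<in> C"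
      and D: "D \<in> Theta B n" "v \<in> D" "w \<in> D"
      by (auto simp: coh_def)
    obtain C' D' where C': "C' \<in> Theta B (max m n)" "C \<subseteq> C'"
      and D': "D' \<in> Theta B (max m n)" "D \<subseteq> D'"
      using Theta_mono[OF C(1), of "max m n"] Theta_mono[OF D(1), of "max m n"] by auto
    have "C' = D'"
      using disjointD[OF partition_onD2[OF partition_on_Theta] C'(1) D'(1)] C(3) C'(2) D(2) D'(2)
      by blast
    then have "u \<in> D'" "w \<in> D'" using C(2) C'(2) D(3) D'(2) by auto
    with D'(1) show "(u, w) \<in> coh B" unfolding coh_def by blast
  qed
qed

text \<open>At a common stage the arguments lie in the same blocks \<open>P\<close> and
  \<open>Q\<close>. The blocks of \<open>c\<close> and \<open>d\<close> then both belong to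
  \<open>Out\<close> of \<open>P\<close> and \<open>Q\<close>, so they are equal or adjacent, and
  the next stage merges them.\<close>

lemma coh_coherent:
  assumes B: "balanced B"
    and car: "x \<in> carrier B" "y \<in> carrier B" "x' \<in> carrier B" "y' \<in> carrier B"
    and x: "(tau B x, tau B x') \<in> coh B" and y: "(tau B y, tau B y') \<in> coh B"
    and c: "c \<in> {tau B (mult B x y), tau B (ldiv B x y), tau B (rdiv B x y)}"
    and d: "d \<in> {tau B (mult B x' y'), tau B (ldiv B x' y'), tau B (rdiv B x' y')}"
  shows "(c, d) \<in> coh B"
proof -
  obtain m n P0 Q0 where P0: "P0 \<in> Theta B m" "tau B x \<in> P0" "tau B x' \<in> P0"
    and Q0: "Q0 \<in> Theta B n" "tau B y \<in> Q0" "tau B y' \<in> Q0"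
    using x y by (auto simp: coh_def)
  let ?k = "max m n"
  obtain P Q where P: "P \<in> Theta B ?k" "P0 \<subseteq> P" and Q: "Q \<in> Theta B ?k" "Q0 \<subseteq> Q"
    using Theta_mono[OF P0(1), of ?k] Theta_mono[OF Q0(1), of ?k] by auto
  have "x \<in> level B P" "x' \<in> level B P" "y \<in> level B Q" "y' \<in> level B Q"
    using P0 P Q0 Q car by (auto simp: level_def)
  then have star: "c \<in> tau_star B P Q" "d \<in> tau_star B P Q"
    using c d unfolding tau_star_def by blast+
  have "c \<in> Sk B" "d \<in> Sk B"
    using c d tau_in_Sk[OF B] balanced_op_closed[OF B] car by (auto simp: op_closed_def)
  then obtain C D where C: "C \<in> Theta B ?k" "c \<in> C" and D: "D \<in> Theta B ?k" "d \<in> D"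
    using partition_onD1[OF partition_on_Theta] by (metis UnionE)
  then have "C \<in> Out B (Theta B ?k) P Q" "D \<in> Out B (Theta B ?k) P Q"
    using star by (auto simp: Out_def)
  then have "(C, D) \<in> (block_graph B (Theta B ?k))\<^sup>*"
    using P Q by (cases "C = D") (auto simp: block_graph_def intro!: r_into_rtrancl)
  then have "\<exists>E\<in>CC_r B (Theta B ?k). c \<in> E \<and> d \<in> E"
    using C D by (auto simp: CC_r_def)
  then have "\<exists>E\<in>Theta B (Suc ?k). c \<in> E \<and> d \<in> E"
    by (simp add: Theta_def)
  then show ?thesis by (auto simp: coh_def)
qed

text \<open>Induction on the stage shows that \<open>f\<close> is constant on blocks. If so, all of
  \<open>tau_star B P Q\<close> has one \<open>f\<close>-value, determined by \<open>g\<close> from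
  the values on \<open>P\<close> and \<open>Q\<close>; adjacent blocks both meet such a set, so
  their constants agree, and this spreads along paths.\<close>

lemma coh_finest:
  assumes op: "\<And>x y. x \<in> carrier B \<Longrightarrow> y \<in> carrier B \<Longrightarrow>
      f (tau B (mult B x y)) = g (f (tau B x)) (f (tau B y)) \<and>
      f (tau B (ldiv B x y)) = g (f (tau B x)) (f (tau B y)) \<and>
      f (tau B (rdiv B x y)) = g (f (tau B x)) (f (tau B y))"
    and "(u, v) \<in> coh B"
  shows "f u = f v"
proof -
  have const: "\<forall>C\<in>Theta B n. \<forall>u\<in>C. \<forall>v\<in>C. f u = f v" for n
  proof (induction n)
    case 0
    then show ?case by (auto simp: Theta_def)
  next
    case (Suc n)
    let ?T = "Theta B n"
    have star: "f c = f d"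
      if PQ: "P \<in> ?T" "Q \<in> ?T" and cd: "c \<in> tau_star B P Q" "d \<in> tau_star B P Q" for P Q c d
    proof -
      obtain x y x' y' where "x \<in> level B P" "x' \<in> level B P" "y \<in> level B Q" "y' \<in> level B Q"
        and "f c = g (f (tau B x)) (f (tau B y))" "f d = g (f (tau B x')) (f (tau B y'))"
        using cd op unfolding tau_star_def level_def by fastforce
      moreover from this have "f (tau B x) = f (tau B x')" "f (tau B y) = f (tau B y')"
        using Suc PQ by (auto simp: level_def)
      ultimately show ?thesis by simp
    qed
    have edge: "f u = f v" if e: "(C, D) \<in> block_graph B ?T" and uv: "u \<in> C" "v \<in> D" for C D u v
    proof -
      obtain P Q c d where "P \<in> ?T" "Q \<in> ?T" "C \<in> ?T" "D \<in> ?T" "c \<in> C" "d \<in> D"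
        "c \<in> tau_star B P Q" "d \<in> tau_star B P Q"
        using e unfolding block_graph_def Out_def by blast
      with star[of P Q c d] Suc uv show ?thesis by metis
    qed
    have path: "C \<in> ?T \<Longrightarrow> D \<in> ?T \<and> (\<forall>u\<in>C. \<forall>v\<in>D. f u = f v)"
      if "(C, D) \<in> (block_graph B ?T)\<^sup>*" for C D
      using that
    proof (induction rule: rtrancl_induct)
      case base
      then show ?case using Suc by blast
    next
      case (step D E)
      have "D \<in> ?T" "E \<in> ?T" using step(2) by (auto simp: block_graph_def Out_def)
      \<comment> \<open>Agreement of \<open>f\<close> across two blocks chains only through a point
        of the middle block.\<close>
      moreover from this have "D \<noteq> {}"
        using partition_onD3[OF partition_on_Theta] by metis
      ultimately show ?case using step edge[OF step(2)] by (metis all_not_in_conv)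
    qed
    \<comment> \<open>Two blocks of one component are compared through a point \<open>w\<close> of
      the block the component was built from.\<close>
    have merge: "f u = f v"
      if C: "C \<in> ?T"
        and DE: "(C, D) \<in> (block_graph B ?T)\<^sup>*" "(C, E) \<in> (block_graph B ?T)\<^sup>*"
        "u \<in> D" "v \<in> E" for C D E u v
    proof -
      obtain w where "w \<in> C"
        using C partition_onD3[OF partition_on_Theta] by (metis all_not_in_conv)
      with path[OF DE(1) C] path[OF DE(2) C] DE(3,4) show ?thesis by metis
    qed
    show ?case
    proof (intro ballI)
      fix K u v assume K: "K \<in> Theta B (Suc n)" "u \<in> K" "v \<in> K"
      have "Theta B (Suc n) = CC_r B ?T" by (simp add: Theta_def)
      with K obtain C where "C \<in> ?T" and "K = \<Union>{D\<in>?T. (C, D) \<in> (block_graph B ?T)\<^sup>*}"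
        unfolding CC_r_def by blast
      with K(2,3) merge[of C] show "f u = f v" by blast
    qed
  qed
  then show ?thesis using assms(2) by (auto simp: coh_def)
qed

section \<open>Residual components\<close>

lemma partition_on_coherentization: "partition_on (Sk B) (coherentization B)"
  unfolding coherentization_eq by (rule partition_on_quotient[OF equiv_coh])

lemma coherentization_related:
  assumes "C \<in> coherentization B" "u \<in> C"
  shows "v \<in> C \<longleftrightarrow> (u, v) \<in> coh B"
proof -
  obtain w where C: "C = coh B `` {w}"
    using assms(1) unfolding coherentization_eq by (rule quotientE)
  with assms(2) have "(w, u) \<in> coh B" by simp
  then have "C = coh B `` {u}" unfolding C by (rule equiv_class_eq[OF equiv_coh])
  then show ?thesis by simp
qed

text \<open>Since \<open>tau\<close> fixes the skeleton pointwise, a level determines its block.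
  This makes levels nonempty and allows blocks to be recovered from carriers.\<close>

lemma Sk_Int_level:
  assumes "balanced B" "C \<in> coherentization B"
  shows "Sk B \<inter> level B C = C"
proof -
  have "C \<subseteq> Sk B" using partition_onD1[OF partition_on_coherentization[of B]] assms(2) by blast
  with Sk_subset_carrier[of B] tau_Sk[OF balanced_residuated[OF assms(1)]] show ?thesis
    by (auto simp: level_def)
qed

text \<open>With \<open>u = tau B x\<close>, the pair \<open>(x, y)\<close> is compared with
  \<open>(u, u)\<close>: the types are related argumentwise, and \<open>uu = u\<close> has type
  \<open>u\<close>. Coherence puts the type of every result from \<open>(x, y)\<close> in the class
  of \<open>u\<close>.\<close>

lemma op_closed_level:
  assumes B: "balanced B" and C: "C \<in> coherentization B"
  shows "op_closed B (level B C)"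
proof -
  have *: "z \<in> level B C"
    if "x \<in> level B C" "y \<in> level B C" and z: "z \<in> {mult B x y, ldiv B x y, rdiv B x y}" for x y z
  proof -
    let ?u = "tau B x"
    have x: "x \<in> carrier B" "?u \<in> C" and y: "y \<in> carrier B" "tau B y \<in> C"
      using that by (auto simp: level_def)
    have u: "?u \<in> Sk B" "?u \<in> carrier B"
      using tau_in_Sk[OF B x(1)] Sk_subset_carrier[of B] by auto
    then have tu: "tau B ?u = ?u" and uu: "mult B ?u ?u = ?u"
      using tau_Sk[OF balanced_residuated[OF B]] by (auto simp: Sk_def)
    have "(?u, tau B z) \<in> coh B"
    proof (rule coh_coherent[OF B u(2) u(2) x(1) y(1)])
      show "(tau B ?u, tau B x) \<in> coh B" "(tau B ?u, tau B y) \<in> coh B"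
        using coherentization_related[OF C x(2)] x(2) y(2) by (simp_all add: tu)
      show "?u \<in> {tau B (mult B ?u ?u), tau B (ldiv B ?u ?u), tau B (rdiv B ?u ?u)}"
        by (simp add: uu tu)
      show "tau B z \<in> {tau B (mult B x y), tau B (ldiv B x y), tau B (rdiv B x y)}"
        using z by auto
    qed
    then have "tau B z \<in> C" using coherentization_related[OF C x(2)] by blast
    moreover have "z \<in> carrier B"
      using z balanced_op_closed[OF B] x y by (auto simp: op_closed_def)
    ultimately show ?thesis by (simp add: level_def)
  qed
  then show ?thesis unfolding op_closed_def by blast
qed

lemma partition_on_levels:
  assumes "balanced B"
  shows "partition_on (carrier B) (level B ` coherentization B)"
proof (rule partition_onI)
  have part: "\<Union>(coherentization B) = Sk B" "disjoint (coherentization B)" "{} \<notin> coherentization B"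
    using partition_on_coherentization[of B] by (auto simp: partition_on_def)
  show "\<Union>(level B ` coherentization B) = carrier B"
    using tau_in_Sk[OF assms] part(1) unfolding level_def by blast
  show "{} \<notin> level B ` coherentization B"
    using Sk_Int_level[OF assms] part(3) by (metis (no_types) Int_empty_right imageE)
  fix p q assume "p \<in> level B ` coherentization B" "q \<in> level B ` coherentization B" "p \<noteq> q"
  then show "disjnt p q"
    using part(2) by (auto simp: level_def disjnt_def disjoint_def)
qed

text \<open>The level of the whole skeleton is the carrier. Conversely, if the carrier is the only
  level, intersecting it with the skeleton shows that every block is the whole skeleton; some block
  exists because the family of levels is nonempty.\<close>

lemma residuation_cohesive_iff_terminal:
  assumes "balanced B"
  shows "residuation_cohesive B \<longleftrightarrow> terminal residual_step B"
proof
  assume "residuation_cohesive B"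
  moreover have "level B (Sk B) = carrier B"
    using tau_in_Sk[OF assms] unfolding level_def by blast
  ultimately show "terminal residual_step B"
    by (simp add: residuation_cohesive_def terminal_def residual_step_def)
next
  assume "terminal residual_step B"
  then have levels: "level B ` coherentization B = {carrier B}"
    by (simp add: terminal_def residual_step_def)
  have "C = Sk B" if "C \<in> coherentization B" for C
    using Sk_Int_level[OF assms that] levels that Sk_subset_carrier[of B] by blast
  with levels show "residuation_cohesive B"
    unfolding residuation_cohesive_def by blast
qed

section \<open>Steady visibility\<close>

text \<open>Visibility gives existence and antisymmetry gives uniqueness of the maximum, so the
  definite description in \<open>proj\<close> denotes it.\<close>

lemma proj_in:
  assumes B: "balanced B" and I: "visible_subsemilattice B I" and r: "r \<in> Sk B"
  shows "proj B I r \<in> I"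
proof -
  have anti: "antisymp_on (carrier B) (le B)"
    using B by (simp add: balanced_def residuated_posemigroup_def)
  have sub: "I \<subseteq> carrier B"
    using I Sk_subset_carrier[of B] by (auto simp: visible_subsemilattice_def)
  obtain m where m: "is_proj B I r m"
    using I r unfolding visible_subsemilattice_def by blast
  have "m' = m" if "is_proj B I r m'" for m'
    using that m sub antisymp_onD[OF anti] unfolding is_proj_def by blast
  with m have "is_proj B I r (proj B I r)"
    unfolding proj_def by (metis theI)
  then show ?thesis by (simp add: is_proj_def)
qed

lemma partition_on_fibres:
  assumes "balanced B" "visible_subsemilattice B I"
  shows "partition_on (carrier B) (fibres B I)"
proof (rule partition_onI)
  show "\<Union>(fibres B I) = carrier B"
    using proj_in[OF assms] tau_in_Sk[OF assms(1)] by (auto simp: fibres_def fibre_def)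
qed (auto simp: fibres_def fibre_def disjnt_def)

lemma level_subset_fibre:
  assumes B: "balanced B" and I: "visible_subsemilattice B I" and steady: "steady_over B I"
    and X: "X \<subseteq> carrier B" "X \<noteq> {}" "op_closed B X"
    and L: "L \<in> level (restr B X) ` coherentization (restr B X)"
  shows "\<exists>F\<in>fibres B I. L \<subseteq> F"
proof -
  let ?X = "restr B X"
  have bal: "balanced ?X" using balanced_restr[OF B X] by simp
  have "L \<noteq> {}" using partition_onD3[OF partition_on_levels[OF bal]] L by blast
  then obtain b where b: "b \<in> L" by blast
  obtain C where C: "C \<in> coherentization ?X" "L = level ?X C" using L by blast
  have bX: "b \<in> carrier B" "b \<in> X" "tau B b \<in> C" using b C X by (auto simp: level_def)
  \<comment> \<open>Steadiness of \<open>B\<close> is read on the elements of \<open>X\<close>. The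
    set \<open>I\<close> may lie partly outside \<open>X\<close>; this is harmless, because
    \<open>coh_finest\<close> puts no condition on where \<open>f\<close> takes its values.\<close>
  have op: "proj B I (tau ?X (mult ?X x y)) = mult B (proj B I (tau ?X x)) (proj B I (tau ?X y)) \<and>
      proj B I (tau ?X (ldiv ?X x y)) = mult B (proj B I (tau ?X x)) (proj B I (tau ?X y)) \<and>
      proj B I (tau ?X (rdiv ?X x y)) = mult B (proj B I (tau ?X x)) (proj B I (tau ?X y))"
    if "x \<in> carrier ?X" "y \<in> carrier ?X" for x y
    using that X(1) steady by (auto simp: steady_over_def Let_def)
  have "proj B I (tau B a) = proj B I (tau B b)" if "a \<in> L" for a
  proof -
    have "(tau B a, tau B b) \<in> coh ?X"
      using coherentization_related[OF C(1)] that C(2) bX by (auto simp: level_def)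
    from coh_finest[where f = "proj B I" and g = "mult B", OF op this] show ?thesis by simp
  qed
  then have sub: "L \<subseteq> fibre B I (proj B I (tau B b))"
    using C(2) X(1) by (auto simp: fibre_def level_def)
  moreover have "proj B I (tau B b) \<in> I"
    using proj_in[OF B I] tau_in_Sk[OF B bX(1)] by blast
  ultimately show ?thesis using b unfolding fibres_def by blast
qed

section \<open>Frontiers\<close>

lemma partition_on_UN_partition:
  assumes "partition_on A F" "\<And>X. X \<in> F \<Longrightarrow> partition_on X (d X)"
  shows "partition_on A (\<Union>X\<in>F. d X)"
proof (rule partition_onI)
  have d: "\<Union>(d X) = X" "disjoint (d X)" "{} \<notin> d X" if "X \<in> F" for X
    using assms(2)[OF that] by (auto simp: partition_on_def)
  show "\<Union>(\<Union>X\<in>F. d X) = A"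
    using d(1) partition_onD1[OF assms(1)] by blast
  show "{} \<notin> (\<Union>X\<in>F. d X)"
    using d(3) by blast
  fix p q assume "p \<in> (\<Union>X\<in>F. d X)" "q \<in> (\<Union>X\<in>F. d X)" and ne: "p \<noteq> q"
  then obtain X Y where X: "X \<in> F" "p \<in> d X" and Y: "Y \<in> F" "q \<in> d Y" by blast
  show "disjnt p q"
  proof (cases "X = Y")
    case True
    with d(2)[OF X(1)] X Y ne show ?thesis by (simp add: pairwise_def)
  next
    case False
    then have "X \<inter> Y = {}" using partition_onD2[OF assms(1)] X Y by (simp add: disjoint_def)
    moreover have "p \<subseteq> X" "q \<subseteq> Y" using d(1) X Y by blast+
    ultimately show ?thesis by (auto simp: disjnt_def)
  qed
qed

text \<open>Sending a fine block to the coarse block around it is surjective, as coarse blocks are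
  nonempty and the fine ones cover. This compares cardinalities for infinite partitions as
  well.\<close>

lemma refines_lepoll:
  assumes "refines A P Q"
  shows "Q \<lesssim> P"
proof -
  have P: "partition_on A P" and Q: "partition_on A Q" and sub: "\<forall>X\<in>P. \<exists>Y\<in>Q. X \<subseteq> Y"
    using assms by (auto simp: refines_def)
  have "Y \<in> (\<lambda>X. SOME Y. Y \<in> Q \<and> X \<subseteq> Y) ` P" if Y: "Y \<in> Q" for Y
  proof -
    obtain y where y: "y \<in> Y" using Y partition_onD3[OF Q] by (metis all_not_in_conv)
    then obtain X where X: "X \<in> P" "y \<in> X"
      using Y partition_onD1[OF P] partition_onD1[OF Q] by blast
    let ?Z = "SOME Y. Y \<in> Q \<and> X \<subseteq> Y"
    have "?Z \<in> Q \<and> X \<subseteq> ?Z" using sub X(1) by (metis (mono_tags, lifting) someI_ex)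
    then have "?Z = Y" using X(2) y Y partition_onD2[OF Q] by (auto simp: disjoint_def)
    with X(1) show ?thesis by (rule_tac image_eqI[where x = X]) simp_all
  qed
  then show ?thesis unfolding lepoll_iff by blast
qed

section \<open>Frontiers of an arbitrary procedure\<close>

definition subalgebra_partition :: "'a rposg \<Rightarrow> 'a set set \<Rightarrow> bool" where
  "subalgebra_partition A F \<longleftrightarrow> partition_on (carrier A) F \<and> (\<forall>X\<in>F. op_closed A X)"

lemma subalgebra_partition_memD:
  assumes "subalgebra_partition A F" "X \<in> F"
  shows "X \<subseteq> carrier A" "X \<noteq> {}" "op_closed A X"
  using assms by (auto simp: subalgebra_partition_def partition_on_def)

lemma frontier_0: "frontier_sequence \<P> A \<F> \<Longrightarrow> \<F> 0 = {carrier A}"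
  by (simp add: frontier_sequence_def)

lemma frontier_Suc:
  assumes "frontier_sequence \<P> A \<F>"
  obtains dec where
    "\<And>X. X \<in> \<F> n \<Longrightarrow> \<not> terminal \<P> (restr A X) \<Longrightarrow> dec X \<in> \<P> (restr A X)"
    "\<F> (Suc n) = (\<Union>X\<in>\<F> n. if terminal \<P> (restr A X) then {X} else dec X)"
proof -
  from assms obtain dec where
    "\<forall>X\<in>\<F> n. \<not> terminal \<P> (restr A X) \<longrightarrow> dec X \<in> \<P> (restr A X)" and
    Suc_eq: "\<F> (Suc n) = (\<Union>X\<in>\<F> n. if terminal \<P> (restr A X) then {X} else dec X)"
    unfolding frontier_sequence_def by (elim conjE allE[of _ n] exE)
  then show thesis by (intro that[OF _ Suc_eq]) simp
qed

text \<open>It suffices to control one application of the procedure to a balanced algebra: each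
  member of a frontier is again balanced, and closure inside a member is closure in \<open>A\<close>
  because restriction leaves the operations unchanged.\<close>

lemma subalgebra_partition_frontier:
  assumes A: "balanced A" and F: "frontier_sequence \<P> A \<F>"
    and step: "\<And>B D. balanced B \<Longrightarrow> D \<in> \<P> B \<Longrightarrow> subalgebra_partition B D"
  shows "subalgebra_partition A (\<F> n)"
proof (induction n)
  case 0
  show ?case
    using A balanced_op_closed balanced_carrier_nonempty partition_on_space
    by (auto simp: frontier_0[OF F] subalgebra_partition_def)
next
  case (Suc n)
  obtain dec where
    dec: "\<And>X. X \<in> \<F> n \<Longrightarrow> \<not> terminal \<P> (restr A X) \<Longrightarrow> dec X \<in> \<P> (restr A X)" and
    Suc_eq: "\<F> (Suc n) = (\<Union>X\<in>\<F> n. if terminal \<P> (restr A X) then {X} else dec X)"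
    by (rule frontier_Suc[OF F, of n]) blast
  let ?d = "\<lambda>X. if terminal \<P> (restr A X) then {X} else dec X"
  have d: "partition_on X (?d X) \<and> (\<forall>Y\<in>?d X. op_closed A Y)" if X: "X \<in> \<F> n" for X
  proof -
    note sub = subalgebra_partition_memD[OF Suc X]
    have "subalgebra_partition (restr A X) (dec X)" if "\<not> terminal \<P> (restr A X)"
      using step[OF balanced_restr(1)[OF A sub]] dec[OF X that] .
    then show ?thesis
      using sub partition_on_space[of X] by (auto simp: subalgebra_partition_def op_closed_def)
  qed
  have "partition_on (carrier A) (\<Union>X\<in>\<F> n. ?d X)"
    using Suc d by (intro partition_on_UN_partition) (auto simp: subalgebra_partition_def)
  with d show ?case unfolding Suc_eq subalgebra_partition_def by blast
qed

lemma terminal_persists: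
  assumes F: "frontier_sequence \<P> A \<F>" and X: "X \<in> \<F> m" "terminal \<P> (restr A X)"
    and "m \<le> n"
  shows "X \<in> \<F> n"
  using \<open>m \<le> n\<close>
proof (induction n rule: dec_induct)
  case base
  show ?case by (rule X(1))
next
  case (step n)
  then show ?case by (rule_tac frontier_Suc[OF F, of n]) (use X(2) in auto)
qed

lemma terminates_stable:
  assumes F: "frontier_sequence \<P> A \<F>" and t: "terminates_at \<P> A \<F> m" and "m \<le> n"
  shows "\<F> n = \<F> m"
  using \<open>m \<le> n\<close>
proof (induction n rule: dec_induct)
  case (step n)
  then show ?case
    by (rule_tac frontier_Suc[OF F, of n]) (use t in \<open>auto simp: terminates_at_def\<close>)
qed simp

text \<open>A terminal component found before stage \<open>m\<close> is carried forward to it, and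
  all stages after \<open>m\<close> coincide with stage \<open>m\<close>.\<close>

lemma terminates_terminal_components:
  assumes F: "frontier_sequence \<P> A \<F>" and t: "terminates_at \<P> A \<F> m"
  shows "terminal_components \<P> A \<F> = \<F> m"
proof
  show "\<F> m \<subseteq> terminal_components \<P> A \<F>"
    using t by (auto simp: terminal_components_def terminates_at_def)
  show "terminal_components \<P> A \<F> \<subseteq> \<F> m"
  proof
    fix X assume "X \<in> terminal_components \<P> A \<F>"
    then obtain n where "X \<in> \<F> n" "terminal \<P> (restr A X)"
      by (auto simp: terminal_components_def)
    then show "X \<in> \<F> m"
      using terminal_persists[OF F, of X n m] terminates_stable[OF F t, of n]
      by (cases "n \<le> m") auto
  qed
qed

section \<open>Frontiers of the residual and the steady procedure\<close>

lemma subalgebra_partition_residual: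
  assumes "balanced B" "D \<in> residual_step B"
  shows "subalgebra_partition B D"
  using assms partition_on_levels op_closed_level
  by (auto simp: subalgebra_partition_def residual_step_def)

lemma subalgebra_partition_steady:
  assumes B: "balanced B" and P: "steady_visibility_procedure \<P>" and D: "D \<in> \<P> B"
  shows "subalgebra_partition B D"
proof -
  obtain I where I: "admissible B I" and D: "D = fibres B I"
    using P D unfolding steady_visibility_procedure_def by blast
  have "op_closed B F" if "F \<in> fibres B I" for F
  proof -
    have "balanced (restr B F)"
      using I that by (auto simp: admissible_def induced_component_def)
    from balanced_op_closed[OF this] show ?thesis by (simp add: op_closed_def)
  qed
  moreover have "partition_on (carrier B) (fibres B I)"
    using partition_on_fibres[OF B] I by (simp add: admissible_def)
  ultimately show ?thesis by (simp add: subalgebra_partition_def D)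
qed

text \<open>\<open>residual_step\<close> has exactly one outcome, and terminality says that this
  outcome is \<open>{X}\<close>, so both branches of the case distinction give the same
  family.\<close>

lemma residual_frontier_Suc:
  assumes "frontier_sequence residual_step A \<R>"
  shows "\<R> (Suc n) = (\<Union>X\<in>\<R> n. level (restr A X) ` coherentization (restr A X))"
proof (rule frontier_Suc[OF assms, of n])
  fix dec
  assume dec: "\<And>X. X \<in> \<R> n \<Longrightarrow> \<not> terminal residual_step (restr A X) \<Longrightarrow>
      dec X \<in> residual_step (restr A X)"
    and eq: "\<R> (Suc n) = (\<Union>X\<in>\<R> n. if terminal residual_step (restr A X) then {X} else dec X)"
  have "(if terminal residual_step (restr A X) then {X} else dec X) =
      level (restr A X) ` coherentization (restr A X)" if "X \<in> \<R> n" for X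
    using dec[OF that] by (auto simp: terminal_def residual_step_def)
  then show ?thesis unfolding eq by (rule SUP_cong[OF refl])
qed

lemma residual_refines_steady:
  assumes A: "balanced A" and P: "steady_visibility_procedure \<P>"
    and R: "frontier_sequence residual_step A \<R>" and S: "frontier_sequence \<P> A \<S>"
  shows "refines (carrier A) (\<R> n) (\<S> n)"
proof -
  have Rp: "subalgebra_partition A (\<R> n)" for n
    using subalgebra_partition_frontier[OF A R subalgebra_partition_residual] .
  have Sp: "subalgebra_partition A (\<S> n)" for n
    using subalgebra_partition_frontier[OF A S subalgebra_partition_steady[OF _ P]] .
  have "\<forall>X\<in>\<R> n. \<exists>Y\<in>\<S> n. X \<subseteq> Y"
  proof (induction n)
    case 0
    then show ?case by (simp add: frontier_0[OF R] frontier_0[OF S])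
  next
    case (Suc n)
    show ?case
    proof
      fix L assume "L \<in> \<R> (Suc n)"
      then obtain X where X: "X \<in> \<R> n"
        and L: "L \<in> level (restr A X) ` coherentization (restr A X)"
        unfolding residual_frontier_Suc[OF R] by blast
      obtain Y where Y: "Y \<in> \<S> n" "X \<subseteq> Y" using Suc X by blast
      note subX = subalgebra_partition_memD[OF Rp X]
      note subY = subalgebra_partition_memD[OF Sp Y(1)]
      have balY: "balanced (restr A Y)" by (rule balanced_restr(1)[OF A subY])
      obtain dec where
        dec: "\<And>X. X \<in> \<S> n \<Longrightarrow> \<not> terminal \<P> (restr A X) \<Longrightarrow> dec X \<in> \<P> (restr A X)" and
        Suc_eq: "\<S> (Suc n) = (\<Union>X\<in>\<S> n. if terminal \<P> (restr A X) then {X} else dec X)"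
        by (rule frontier_Suc[OF S, of n]) blast
      show "\<exists>Y\<in>\<S> (Suc n). L \<subseteq> Y"
      proof (cases "terminal \<P> (restr A Y)")
        case True
        have "Y \<in> \<S> (Suc n)"
          unfolding Suc_eq by (rule UN_I[OF Y(1)]) (simp add: True)
        moreover have "L \<subseteq> X" using L by (auto simp: level_def)
        ultimately show ?thesis using Y(2) by blast
      next
        case False
        then obtain I where I: "admissible (restr A Y) I" and decY: "dec Y = fibres (restr A Y) I"
          using dec[OF Y(1)] P unfolding steady_visibility_procedure_def by blast
        \<comment> \<open>The ambient algebra is \<open>restr A Y\<close>. Restricting it further to
          \<open>X\<close> gives \<open>restr A X\<close>, the algebra in which \<open>L\<close> was
          formed.\<close>
        obtain F where F: "F \<in> fibres (restr A Y) I" "L \<subseteq> F"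
          using level_subset_fibre[OF balY, of I X L] I L subX Y(2)
          by (auto simp: admissible_def op_closed_def)
        have "F \<in> \<S> (Suc n)"
          unfolding Suc_eq by (rule UN_I[OF Y(1)]) (simp add: False decY F(1))
        with F(2) show ?thesis by blast
      qed
    qed
  qed
  with Rp Sp show ?thesis by (simp add: refines_def subalgebra_partition_def)
qed

theorem theorem8p11:
  fixes A :: "'a rposg" and \<P> :: "'a procedure" and \<R> \<S> :: "nat \<Rightarrow> 'a set set"
  assumes "balanced A"
    and "steady_visibility_procedure \<P>"
    and "frontier_sequence residual_step A \<R>"
    and "frontier_sequence \<P> A \<S>"
  shows "(\<forall>n. refines (carrier A) (\<R> n) (\<S> n)) \<and>
    (\<forall>n. finite (\<R> n) \<and> finite (\<S> n) \<longrightarrow> card (\<R> n) \<ge> card (\<S> n)) \<and>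
    (\<forall>M N. terminates_at \<P> A \<S> N \<and> terminates_at residual_step A \<R> M \<longrightarrow>
       refines (carrier A) (\<R> M) (\<S> N) \<and>
       (\<forall>X\<in>\<R> M. induced_component (restr A X) A) \<and>
       restr A ` \<R> M =
         restr A ` {X \<in> terminal_components residual_step A \<R>. residuation_cohesive (restr A X)} \<and>
       \<S> N = terminal_components \<P> A \<S> \<and>
       (\<forall>X\<in>\<R> M. \<exists>!Y. Y \<in> \<S> N \<and> X \<subseteq> Y) \<and>
       (\<forall>Y\<in>\<S> N. partition_on Y {X \<in> \<R> M. X \<subseteq> Y}) \<and>
       \<S> N \<lesssim> \<R> M \<and>
       (\<forall>X\<in>\<R> M. \<forall>Y\<in>\<S> N. X \<subseteq> Y \<longrightarrow> induced_component (restr A X) (restr A Y)))"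
proof -
  note A = assms(1) and P = assms(2) and R = assms(3) and S = assms(4)
  have Rp: "subalgebra_partition A (\<R> n)" for n
    using subalgebra_partition_frontier[OF A R subalgebra_partition_residual] .
  have Sp: "subalgebra_partition A (\<S> n)" for n
    using subalgebra_partition_frontier[OF A S subalgebra_partition_steady[OF _ P]] .
  have refines: "refines (carrier A) (\<R> n) (\<S> n)" for n
    by (rule residual_refines_steady[OF A P R S])
  have card: "card (\<R> n) \<ge> card (\<S> n)" if "finite (\<R> n)" "finite (\<S> n)" for n
    using refines_lepoll[OF refines[of n]] that by (simp add: lepoll_iff_card_le)
  have final: "refines (carrier A) (\<R> M) (\<S> N) \<and>
       (\<forall>X\<in>\<R> M. induced_component (restr A X) A) \<and>
       restr A ` \<R> M =
         restr A ` {X \<in> terminal_components residual_step A \<R>. residuation_cohesive (restr A X)} \<and>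
       \<S> N = terminal_components \<P> A \<S> \<and>
       (\<forall>X\<in>\<R> M. \<exists>!Y. Y \<in> \<S> N \<and> X \<subseteq> Y) \<and>
       (\<forall>Y\<in>\<S> N. partition_on Y {X \<in> \<R> M. X \<subseteq> Y}) \<and>
       \<S> N \<lesssim> \<R> M \<and>
       (\<forall>X\<in>\<R> M. \<forall>Y\<in>\<S> N. X \<subseteq> Y \<longrightarrow> induced_component (restr A X) (restr A Y))"
    if tS: "terminates_at \<P> A \<S> N" and tR: "terminates_at residual_step A \<R> M" for M N
  proof (intro conjI)
    \<comment> \<open>The stages \<open>M\<close> and \<open>N\<close> may differ; at stage
      \<open>max M N\<close> both frontiers have already become stationary.\<close>
    show ref: "refines (carrier A) (\<R> M) (\<S> N)"
      using refines[of "max M N"] terminates_stable[OF R tR, of "max M N"]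
        terminates_stable[OF S tS, of "max M N"] by simp
    show "\<forall>X\<in>\<R> M. induced_component (restr A X) A"
      by (intro ballI induced_component_restr[OF A] subalgebra_partition_memD[OF Rp])
    have "residuation_cohesive (restr A X)" if "X \<in> \<R> M" for X
    proof -
      have "balanced (restr A X)"
        by (rule balanced_restr(1)[OF A subalgebra_partition_memD[OF Rp that]])
      then show ?thesis
        using tR that by (simp add: residuation_cohesive_iff_terminal terminates_at_def)
    qed
    then show "restr A ` \<R> M =
        restr A ` {X \<in> terminal_components residual_step A \<R>. residuation_cohesive (restr A X)}"
      unfolding terminates_terminal_components[OF R tR]
      by (intro arg_cong[where f = "image (restr A)"]) blast
    show "\<S> N = terminal_components \<P> A \<S>"
      by (simp add: terminates_terminal_components[OF S tS])
    show "\<forall>X\<in>\<R> M. \<exists>!Y. Y \<in> \<S> N \<and> X \<subseteq> Y"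
    proof
      fix X assume X: "X \<in> \<R> M"
      then obtain Y where Y: "Y \<in> \<S> N" "X \<subseteq> Y" using ref by (auto simp: refines_def)
      \<comment> \<open>The nonempty set \<open>X\<close> lies in both members of a partition, so
        they cannot be disjoint.\<close>
      have "Z = Y" if "Z \<in> \<S> N" "X \<subseteq> Z" for Z
        using disjointD[OF partition_onD2 that(1) Y(1)] Sp[of N] that(2) Y(2)
          subalgebra_partition_memD(2)[OF Rp X] unfolding subalgebra_partition_def by blast
      with Y show "\<exists>!Y. Y \<in> \<S> N \<and> X \<subseteq> Y" by blast
    qed
    show "\<forall>Y\<in>\<S> N. partition_on Y {X \<in> \<R> M. X \<subseteq> Y}"
      by (intro ballI refines_obtains_subset[OF ref])
    show "\<S> N \<lesssim> \<R> M" by (rule refines_lepoll[OF ref])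
    show "\<forall>X\<in>\<R> M. \<forall>Y\<in>\<S> N. X \<subseteq> Y \<longrightarrow> induced_component (restr A X) (restr A Y)"
    proof (intro ballI impI)
      fix X Y assume X: "X \<in> \<R> M" and Y: "Y \<in> \<S> N" and "X \<subseteq> Y"
      have "balanced (restr A Y)"
        by (rule balanced_restr(1)[OF A subalgebra_partition_memD[OF Sp Y]])
      \<comment> \<open>The ambient algebra is now \<open>restr A Y\<close>, so the skeleton
        condition refers to the skeleton of \<open>Y\<close>; closure of \<open>X\<close> transfers
        since the operations are those of \<open>A\<close>.\<close>
      from induced_component_restr[OF this, of X] \<open>X \<subseteq> Y\<close> subalgebra_partition_memD[OF Rp X]
      show "induced_component (restr A X) (restr A Y)" by (simp add: op_closed_def)
    qed
  qed
  show ?thesis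
  proof (rule conjI[OF allI conjI[OF allI allI]])
    show "refines (carrier A) (\<R> n) (\<S> n)" for n by (rule refines)
    show "finite (\<R> n) \<and> finite (\<S> n) \<longrightarrow> card (\<R> n) \<ge> card (\<S> n)" for n
      using card by blast
  qed (intro allI impI, erule conjE, rule final)
qed

end
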